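(* Let $\{F_t\}_{t\ge0}$ be a nice Feller process on $\mathbb{R}^d$ with symbol $q(x,\xi)$, diffusion coefficient $c(x)$ and Lévy measure $\nu(x,dy)$. (i) If $\{F_t\}_{t\ge0}$ is symmetric, $d\in\{1,2\}$ and $\sup_{x\in\mathbb{R}^d}\int_{\mathbb{R}^d}|y|^2\nu(x,dy)<\infty$, then $$\int_{\{|\xi|<r\}}\frac{d\xi}{\sup_{x\in\mathbb{R}^d}|q(x,\xi)|}=\infty\quad\text{for some } r>0.$$ (ii) If $d\ge3$ and $$\liminf_{|\xi|\to0}\frac{\sup_{R>0}\inf_{x\in\mathbb{R}^d}\left(\langle\xi,c(x)\xi\rangle+\int_{\{|y|\le R\}}\langle\xi,y\rangle^2\nu(x,dy)\right)}{|\xi|^2}>0,$$ then $$\int_{\{|\xi|<r\}}\frac{d\xi}{\inf_{x\in\mathbb{R}^d}\operatorname{Re}q(x,\xi)}<\infty\quad\text{for some } r>0.$$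
   Context: A Feller process $\{F_t\}_{t\ge0}$ on $\mathbb{R}^d$ is a Markov process with state space $(\mathbb{R}^d,\mathcal{B}(\mathbb{R}^d))$, with laws $\mathbb{P}^x$ and expectations $\mathbb{E}^x$ (starting point $x\in\mathbb{R}^d$), whose semigroup $P_tf(x)=\mathbb{E}^x[f(F_t)]$ maps $C_\infty(\mathbb{R}^d)$ (continuous functions vanishing at infinity, with the supremum norm) into itself and is strongly continuous there; it is strong Markov with càdlàg paths. Let $(\mathcal{A},\mathcal{D}_{\mathcal{A}})$ be its (Feller) generator. Condition (C1): $C_c^\infty(\mathbb{R}^d)\subseteq\mathcal{D}_{\mathcal{A}}$. Under (C1), for $f\in C_c^\infty(\mathbb{R}^d)$, $\mathcal{A}f(x)=-\int_{\mathbb{R}^d}q(x,\xi)e^{i\langle\xi,x\rangle}\hat f(\xi)\,d\xi$ with $\hat f(\xi)=(2\pi)^{-d}\int e^{-i\langle\xi,x\rangle}f(x)\,dx$, where the function $q:\mathbb{R}^d\times\mathbb{R}^d\to\mathbb{C}$, called the symbol, has for each $x$ the form $$q(x,\xi)=a(x)-i\langle\xi,b(x)\rangle+\tfrac12\langle\xi,c(x)\xi\rangle-\int_{\mathbb{R}^d}\left(e^{i\langle\xi,y\rangle}-1-i\langle\xi,y\rangle1_{\{|y|\le1\}}\right)\nu(x,dy),$$ with $a\ge0$, $b(x)\in\mathbb{R}^d$, $c(x)$ a symmetric nonnegative definite $d\times d$ matrix (all Borel measurable in $x$) and $\nu(x,dy)$ a Borel kernel (the Lévy measure) with $\nu(x,\{0\})=0$,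 $\int\min\{1,|y|^2\}\nu(x,dy)<\infty$. Condition (C2): there is $C\ge0$ with $\sup_x|q(x,\xi)|\le C(1+|\xi|^2)$ for all $\xi$; equivalently $b$, $c$ and $x\mapsto\int\min\{1,|y|^2\}\nu(x,dy)$ (and $a$) are bounded. Condition (C3): $q(x,0)=a(x)=0$ for all $x$. The process is $\varphi$-irreducible, for a $\sigma$-finite measure $\varphi$ on $\mathcal{B}(\mathbb{R}^d)$, if $\varphi(B)>0$ implies $\int_0^\infty\mathbb{P}^x(F_t\in B)\,dt>0$ for all $x$; then there is a maximal irreducibility measure $\psi$ (i.e. the process is $\bar\varphi$-irreducible iff $\bar\varphi\ll\psi$). Condition (C4): the process is irreducible and its maximal irreducibility measure $\psi$ satisfies $\psi(O)>0$ for every nonempty open set $O\subseteq\mathbb{R}^d$. A nice Feller process is a Feller process satisfying (C1)-(C4). It is symmetric if $q=\operatorname{Re}q$, i.e. $b(x)=0$ and $\nu(x,dy)$ is a symmetric measure for every $x$. Convention: $1/0=\infty$ in integrands. *)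

theory Defs
  imports "HOL-Probability.Probability"
begin

section \<open>Function spaces on Euclidean space\<close>

text \<open>Continuous functions vanishing at infinity. Convergence in the supremum norm is expressed
  by \<^term>\<open>uniform_limit UNIV\<close>.\<close>

definition C_infty :: "('a::euclidean_space \<Rightarrow> real) set" where
  "C_infty = {f. continuous_on UNIV f \<and> (f \<longlongrightarrow> 0) at_infinity}"

text \<open>\<open>k\<close> times continuously differentiable, phrased with all directional derivatives
  \<open>\<lambda>x. f' x v\<close>; since \<open>f' x\<close> is linear these are combinations of the partial derivatives.\<close>

primrec C_diff :: "nat \<Rightarrow> ('a::euclidean_space \<Rightarrow> real) \<Rightarrow> bool" where
  "C_diff 0 f \<longleftrightarrow> continuous_on UNIV f"
| "C_diff (Suc k) f \<longleftrightarrow>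
     (\<exists>f'. (\<forall>x. (f has_derivative f' x) (at x)) \<and> (\<forall>v. C_diff k (\<lambda>x. f' x v)))"

definition test_functions :: "('a::euclidean_space \<Rightarrow> real) set" where
  "test_functions = {f. (\<forall>k. C_diff k f) \<and> compact (closure {x. f x \<noteq> 0})}"

definition fourier_transform :: "(real^'n \<Rightarrow> real) \<Rightarrow> real^'n \<Rightarrow> complex" where
  "fourier_transform f \<xi> =
     (LINT x|lborel. iexp (- (\<xi> \<bullet> x)) * of_real (f x)) / of_real ((2 * pi) ^ CARD('n))"


section \<open>Feller processes\<close>

definition cadlag :: "(real \<Rightarrow> 'a::topological_space) \<Rightarrow> bool" where
  "cadlag f \<longleftrightarrow> (\<forall>t\<ge>0. (f \<longlongrightarrow> f t) (at_right t)) \<and> (\<forall>t>0. \<exists>l. (f \<longlongrightarrow> l) (at_left t))"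

text \<open>Time is \<open>[0, \<infinity>)\<close>: the process \<open>X\<close> is only constrained at times \<open>t \<ge> 0\<close>. The library's
  filtrations are indexed by a whole type; a filtration \<open>Flt\<close> on \<open>[0, \<infinity>)\<close> is regarded as indexed
  by \<^typ>\<open>real\<close> via \<open>\<lambda>t. Flt (max 0 t)\<close>. The measurable space \<open>M\<close> carries the laws \<open>P x\<close>; the
  measure of \<open>M\<close> itself (and those of \<open>Flt t\<close>) play no role.\<close>

locale markov_process = filtration "space M" Flt
  for M :: "'w measure" and Flt :: "real \<Rightarrow> 'w measure" +
  fixes P :: "real^'n \<Rightarrow> 'w measure"
    and X :: "real \<Rightarrow> 'w \<Rightarrow> real^'n"
  assumes subalgebra_Flt: "\<And>t. subalgebra M (Flt t)"
    and prob_space_P: "\<And>x. prob_space (P x)"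
    and sets_P: "\<And>x. sets (P x) = sets M"
    and adapted: "\<And>t. t \<ge> 0 \<Longrightarrow> X t \<in> borel_measurable (Flt t)"
    and measurable_transition: "\<And>t B. t \<ge> 0 \<Longrightarrow> B \<in> sets borel \<Longrightarrow>
      (\<lambda>x. measure (P x) {\<omega> \<in> space M. X t \<omega> \<in> B}) \<in> borel_measurable borel"
    and start: "\<And>x. AE \<omega> in P x. X 0 \<omega> = x"
    and markov: "\<And>x s t B. s \<ge> 0 \<Longrightarrow> t \<ge> 0 \<Longrightarrow> B \<in> sets borel \<Longrightarrow>
      AE \<omega> in P x. real_cond_exp (P x) (Flt s) (indicator {\<omega>' \<in> space M. X (s + t) \<omega>' \<in> B}) \<omega>
        = measure (P (X s \<omega>)) {\<omega>' \<in> space M. X t \<omega>' \<in> B}"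

definition semigroup_of ::
    "(real^'n \<Rightarrow> 'w measure) \<Rightarrow> (real \<Rightarrow> 'w \<Rightarrow> real^'n) \<Rightarrow> real \<Rightarrow> (real^'n \<Rightarrow> real) \<Rightarrow> real^'n \<Rightarrow> real" where
  "semigroup_of P X t f x = (LINT \<omega>|P x. f (X t \<omega>))"

text \<open>The strong Markov property need not be assumed: it follows from the conditions below.\<close>

locale feller_process = markov_process M Flt P X
  for M :: "'w measure" and Flt :: "real \<Rightarrow> 'w measure"
    and P :: "real^'n \<Rightarrow> 'w measure" and X :: "real \<Rightarrow> 'w \<Rightarrow> real^'n" +
  assumes feller: "\<And>t f. t \<ge> 0 \<Longrightarrow> f \<in> C_infty \<Longrightarrow> semigroup_of P X t f \<in> C_infty"
    and strongly_continuous: "\<And>f. f \<in> C_infty \<Longrightarrow>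
      uniform_limit UNIV (\<lambda>t. semigroup_of P X t f) f (at_right 0)"
    and cadlag_paths: "\<And>\<omega>. \<omega> \<in> space M \<Longrightarrow> cadlag (\<lambda>t. X t \<omega>)"

definition is_generator_value ::
    "(real^'n \<Rightarrow> 'w measure) \<Rightarrow> (real \<Rightarrow> 'w \<Rightarrow> real^'n) \<Rightarrow> (real^'n \<Rightarrow> real) \<Rightarrow> (real^'n \<Rightarrow> real) \<Rightarrow> bool" where
  "is_generator_value P X f g \<longleftrightarrow> f \<in> C_infty \<and> g \<in> C_infty \<and>
     uniform_limit UNIV (\<lambda>t x. (semigroup_of P X t f x - f x) / t) g (at_right 0)"

definition generator_domain ::
    "(real^'n \<Rightarrow> 'w measure) \<Rightarrow> (real \<Rightarrow> 'w \<Rightarrow> real^'n) \<Rightarrow> (real^'n \<Rightarrow> real) set" where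
  "generator_domain P X = {f. \<exists>g. is_generator_value P X f g}"

definition generator ::
    "(real^'n \<Rightarrow> 'w measure) \<Rightarrow> (real \<Rightarrow> 'w \<Rightarrow> real^'n) \<Rightarrow> (real^'n \<Rightarrow> real) \<Rightarrow> real^'n \<Rightarrow> real" where
  "generator P X f = (THE g. is_generator_value P X f g)"


section \<open>Irreducibility\<close>

definition irreducible_wrt ::
    "(real^'n \<Rightarrow> 'w measure) \<Rightarrow> (real \<Rightarrow> 'w \<Rightarrow> real^'n) \<Rightarrow> (real^'n) measure \<Rightarrow> bool" where
  "irreducible_wrt P X \<phi> \<longleftrightarrow> sigma_finite_measure \<phi> \<and> sets \<phi> = sets borel \<and>
     (\<forall>B\<in>sets borel. emeasure \<phi> B > 0 \<longrightarrow>
       (\<forall>x. (\<integral>\<^sup>+t\<in>{0..}. emeasure (P x) {\<omega> \<in> space (P x). X t \<omega> \<in> B} \<partial>lborel) > 0))"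

text \<open>\<^term>\<open>absolutely_continuous \<psi> \<phi>\<close> is the library's notation for \<open>\<phi> \<lless> \<psi>\<close>. The
  choice \<open>\<phi> = \<psi>\<close> below shows that the process is in particular \<open>\<psi>\<close>-irreducible.\<close>

definition maximal_irreducibility_measure ::
    "(real^'n \<Rightarrow> 'w measure) \<Rightarrow> (real \<Rightarrow> 'w \<Rightarrow> real^'n) \<Rightarrow> (real^'n) measure \<Rightarrow> bool" where
  "maximal_irreducibility_measure P X \<psi> \<longleftrightarrow> sigma_finite_measure \<psi> \<and> sets \<psi> = sets borel \<and>
     (\<forall>\<phi>. sigma_finite_measure \<phi> \<and> sets \<phi> = sets borel \<longrightarrow>
       (irreducible_wrt P X \<phi> \<longleftrightarrow> absolutely_continuous \<psi> \<phi>))"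


section \<open>Symbols and nice Feller processes\<close>

definition levy_khintchine ::
    "real \<Rightarrow> real^'n \<Rightarrow> real^'n^'n \<Rightarrow> (real^'n) measure \<Rightarrow> real^'n \<Rightarrow> complex" where
  "levy_khintchine a b c \<nu> \<xi> =
     of_real a - \<i> * of_real (\<xi> \<bullet> b) + of_real (\<xi> \<bullet> (c *v \<xi>)) / 2
     - (LINT y|\<nu>. iexp (\<xi> \<bullet> y) - 1 - \<i> * of_real (\<xi> \<bullet> y) * indicator {y. norm y \<le> 1} y)"

text \<open>The characteristics \<open>(a, b, c, \<nu>)\<close> are determined by the symbol \<open>q\<close>, and \<open>q\<close> by the
  generator on test functions, so taking them as parameters adds no freedom.\<close>

locale nice_feller_process = feller_process M Flt P X
  for M :: "'w measure" and Flt :: "real \<Rightarrow> 'w measure"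
    and P :: "real^'n \<Rightarrow> 'w measure" and X :: "real \<Rightarrow> 'w \<Rightarrow> real^'n" +
  fixes q :: "real^'n \<Rightarrow> real^'n \<Rightarrow> complex"
    and a :: "real^'n \<Rightarrow> real"
    and b :: "real^'n \<Rightarrow> real^'n"
    and c :: "real^'n \<Rightarrow> real^'n^'n"
    and \<nu> :: "real^'n \<Rightarrow> (real^'n) measure"
  assumes C1: "test_functions \<subseteq> generator_domain P X"
    and generator_eq: "\<And>f x. f \<in> test_functions \<Longrightarrow>
      of_real (generator P X f x) =
        - (LINT \<xi>|lborel. q x \<xi> * iexp (\<xi> \<bullet> x) * fourier_transform f \<xi>)"
    and symbol_eq: "\<And>x \<xi>. q x \<xi> = levy_khintchine (a x) (b x) (c x) (\<nu> x) \<xi>"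
    and a_measurable: "a \<in> borel_measurable borel"
    and a_nonneg: "\<And>x. a x \<ge> 0"
    and b_measurable: "b \<in> borel_measurable borel"
    and c_measurable: "c \<in> borel_measurable borel"
    and c_symmetric: "\<And>x. transpose (c x) = c x"
    and c_nonneg: "\<And>x \<xi>. \<xi> \<bullet> (c x *v \<xi>) \<ge> 0"
    and sets_\<nu>: "\<And>x. sets (\<nu> x) = sets borel"
    and \<nu>_kernel: "\<And>B. B \<in> sets borel \<Longrightarrow> (\<lambda>x. emeasure (\<nu> x) B) \<in> borel_measurable borel"
    and \<nu>_zero: "\<And>x. emeasure (\<nu> x) {0} = 0"
    and \<nu>_integrable: "\<And>x. (\<integral>\<^sup>+y. ennreal (min 1 ((norm y)\<^sup>2)) \<partial>\<nu> x) < \<infinity>"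
    and C2: "\<exists>C\<ge>0. \<forall>x \<xi>. norm (q x \<xi>) \<le> C * (1 + (norm \<xi>)\<^sup>2)"
    and C3: "\<And>x. q x 0 = of_real (a x)" "\<And>x. a x = 0"
    and C4: "\<exists>\<psi>. maximal_irreducibility_measure P X \<psi> \<and>
      (\<forall>U. open U \<and> U \<noteq> {} \<longrightarrow> emeasure \<psi> U > 0)"

definition symmetric_symbol :: "(real^'n \<Rightarrow> real^'n \<Rightarrow> complex) \<Rightarrow> bool" where
  "symmetric_symbol q \<longleftrightarrow> (\<forall>x \<xi>. q x \<xi> = of_real (Re (q x \<xi>)))"

end

theory Submission
  imports Defs
begin

text \<open>Near the origin the symbol is squeezed between multiples of \<open>|\<xi>|\<^sup>2\<close>, and \<open>|\<xi>|\<^sup>-\<^sup>2\<close> is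
  integrable at \<open>0\<close> exactly when \<open>d \<ge> 3\<close>. With \<open>Re q(x,\<xi>) = \<langle>\<xi>,c(x)\<xi>\<rangle>/2 + \<integral>(1 - cos\<langle>\<xi>,y\<rangle>)\<nu>(x,dy)\<close>,
  the bound \<open>1 - cos u \<le> u\<^sup>2/2\<close> gives the upper estimate in (i). In (ii) the bound
  \<open>1 - cos u \<ge> u\<^sup>2/4\<close> for \<open>|u| \<le> 1\<close> gives the lower estimate for \<open>|\<xi>| \<le> 1/R\<close>, once a truncation
  radius \<open>R\<close> has been found that serves all directions of \<open>\<xi>\<close> simultaneously.\<close>

section \<open>Elementary bounds for \<open>1 - cos u\<close> and for reciprocals\<close>

lemma one_minus_cos_le:
  fixes u :: real
  shows "1 - cos u \<le> u\<^sup>2 / 2"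
proof -
  have "1 - cos u = 2 * (sin (u / 2))\<^sup>2"
    using cos_double_sin[of "u / 2"] by simp
  also have "(sin (u / 2))\<^sup>2 \<le> (u / 2)\<^sup>2"
    using abs_sin_x_le_abs_x[of "u / 2"] by (simp add: abs_le_square_iff del: abs_divide)
  finally show ?thesis by (simp add: power_divide)
qed

text \<open>In the Taylor expansion of order four the remainder is at most \<open>u^4 / 24\<close>.
  For \<open>|u| \<le> 1\<close> this costs no more than half of the leading term
  \<open>u^2 / 2\<close>.\<close>

lemma one_minus_cos_ge:
  fixes u :: real
  assumes "\<bar>u\<bar> \<le> 1"
  shows "u\<^sup>2 / 4 \<le> 1 - cos u"
proof -
  obtain t where t: "cos u = (\<Sum>m<4. cos_coeff m * u ^ m) + cos (t + 1 / 2 * real 4 * pi) / fact 4 * u ^ 4"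
    using Maclaurin_cos_expansion[of u 4] by blast
  have eq: "cos u = 1 - u\<^sup>2 / 2 + cos (t + 2 * pi) / 24 * u ^ 4"
  proof -
    have "{..<4::nat} = {0, 1, 2, 3}" by auto
    then show ?thesis unfolding t by (simp add: cos_coeff_def fact_numeral)
  qed
  have "cos (t + 2 * pi) / 24 * u ^ 4 \<le> 1 / 24 * u ^ 4"
    by (intro mult_right_mono divide_right_mono cos_le_one) auto
  also have "\<dots> \<le> 1 / 4 * u\<^sup>2"
  proof -
    have "u\<^sup>2 * u\<^sup>2 \<le> 1 * u\<^sup>2"
      using assms by (intro mult_right_mono) (auto simp: abs_square_le_1)
    moreover have "u ^ 4 = u\<^sup>2 * u\<^sup>2" by (simp flip: power_add)
    moreover have "0 \<le> u\<^sup>2" by simp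
    ultimately show ?thesis by linarith
  qed
  finally show ?thesis unfolding eq by linarith
qed

text \<open>Zero is included because \<open>inverse 0 = \<infinity>\<close> in
  \<open>ennreal\<close>, which is also the convention 1/0 = \<infinity> for the integrands.\<close>

lemma inverse_ennreal_antimono: "x \<le> y \<Longrightarrow> inverse y \<le> inverse (x::ennreal)"
  by (cases "x = 0"; cases x; cases y) (auto simp: inverse_ennreal ennreal_le_iff top_unique less_le)

section \<open>Integrability of negative powers of the norm at the origin\<close>

text \<open>On a ball of radius \<open>s \<le> 1\<close> the integrand is at least s^(-d), with d
  the dimension, which cancels the volume \<open>V * s^d\<close>. If the integral were finite,
  continuity from above along balls shrinking to the origin would force
  \<open>V \<le> 0\<close>.\<close>

lemma nn_integral_inverse_norm_power_ball_infinite: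
  assumes "DIM('a::euclidean_space) \<le> k" "0 < r"
  shows "(\<integral>\<^sup>+x\<in>ball 0 r. inverse (ennreal (norm (x::'a) ^ k)) \<partial>lborel) = \<infinity>"
proof (rule ccontr)
  define f where "f x = inverse (ennreal (norm (x::'a) ^ k))" for x
  define N where "N = density lborel f"
  \<comment> \<open>The measure with density \<open>f\<close> is at least \<open>V\<close> on each ball \<open>B n\<close>, although these shrink to a null set.\<close>
  define B where "B n = ball (0::'a) (min 1 r / Suc n)" for n :: nat
  define V where "V = unit_ball_vol (real DIM('a))"
  have f[measurable]: "f \<in> borel_measurable borel" unfolding f_def by measurable
  assume "\<not> ?thesis"
  then have fin: "(\<integral>\<^sup>+x\<in>ball 0 r. f x \<partial>lborel) < \<infinity>"
    by (simp add: f_def top.not_eq_extremum)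
  have N: "emeasure N A = (\<integral>\<^sup>+x\<in>A. f x \<partial>lborel)" if "A \<in> sets borel" for A
    using that by (simp add: N_def emeasure_density)
  have ge: "ennreal V \<le> emeasure N (B n)" for n
  proof -
    define s where "s = min 1 r / Suc n"
    \<comment> \<open>The minimum with 1 lets the exponent drop from \<open>k\<close> to the
      dimension; the minimum with \<open>r\<close> keeps the balls where finiteness was
      assumed.\<close>
    have s: "0 < s" "s \<le> 1"
      using assms(2) by (auto simp: s_def field_simps min_def)
    have "ennreal V = inverse (ennreal (s ^ DIM('a))) * emeasure lborel (ball (0::'a) s)"
      using s by (simp add: emeasure_ball V_def unit_ball_vol_nonneg inverse_ennreal flip: ennreal_mult)
    also have "\<dots> = (\<integral>\<^sup>+x\<in>ball 0 s. inverse (ennreal (s ^ DIM('a))) \<partial>(lborel::'a measure))"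
      by (simp add: nn_integral_cmult_indicator)
    also have "\<dots> \<le> (\<integral>\<^sup>+x\<in>ball 0 s. f x \<partial>lborel)"
    proof (rule nn_integral_mono)
      fix x :: 'a
      have "norm x ^ k \<le> s ^ DIM('a)" if "norm x < s"
      proof -
        have "norm x ^ k \<le> s ^ k" using that by (intro power_mono) auto
        also have "\<dots> \<le> s ^ DIM('a)" using s assms(1) by (intro power_decreasing) auto
        finally show ?thesis .
      qed
      then show "inverse (ennreal (s ^ DIM('a))) * indicator (ball 0 s) x \<le> f x * indicator (ball 0 s) x"
        by (auto simp: f_def indicator_def intro!: inverse_ennreal_antimono ennreal_leI)
    qed
    finally show ?thesis by (simp add: N B_def s_def)
  qed
  have dec: "decseq B"
    using assms(2) by (auto simp: decseq_def B_def min_def intro!: subset_ball divide_left_mono)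
  have "emeasure N (B n) \<noteq> \<infinity>" for n
  proof -
    have "min 1 r / Suc n \<le> r / 1"
      using assms(2) by (intro frac_le) auto
    then have "emeasure N (B n) \<le> emeasure N (ball 0 r)"
      by (intro emeasure_mono) (auto simp: B_def N_def)
    with fin show ?thesis by (auto simp: N top.not_eq_extremum)
  qed
  then have lim: "(\<lambda>n. emeasure N (B n)) \<longlonglongrightarrow> emeasure N (\<Inter>n. B n)"
    using dec by (intro Lim_emeasure_decseq) (auto simp: N_def, auto simp: B_def)
  have "(\<Inter>n. B n) = {0}"
  proof (intro set_eqI iffI)
    fix x assume x: "x \<in> (\<Inter>n. B n)"
    have "norm x \<le> 0"
    proof (rule field_le_epsilon)
      fix e :: real assume "0 < e"
      then obtain n where n: "inverse (real (Suc n)) < e" using reals_Archimedean by blast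
      have "norm x < min 1 r / Suc n" using x by (auto simp: B_def)
      also have "\<dots> \<le> 1 / Suc n" by (intro divide_right_mono) auto
      finally show "norm x \<le> 0 + e" using n by (simp add: inverse_eq_divide)
    qed
    then show "x \<in> {0}" by simp
  qed (use assms(2) in \<open>auto simp: B_def\<close>)
  then have "emeasure N (\<Inter>n. B n) = 0"
    by (simp add: N_def emeasure_density nn_integral_0_iff_AE)
  with lim ge have "ennreal V \<le> 0"
    by (intro LIMSEQ_le_const) (auto intro: exI[of _ 0])
  moreover have "0 < V" unfolding V_def by (rule unit_ball_vol_pos) simp
  ultimately show False by (simp add: ennreal_eq_0_iff)
qed

text \<open>Dyadic decomposition: on the shell \<open>s (Suc n) \<le> norm x < s n\<close> the
  integrand is at most \<open>1 / s (Suc n) ^ k\<close>. Enlarging each shell to the ball of radius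
  \<open>s n\<close> still leaves a series dominated by a geometric one, since \<open>k\<close> is
  below the dimension.\<close>

lemma nn_integral_inverse_norm_power_ball_finite:
  assumes "k < DIM('a::euclidean_space)" "0 < r"
  shows "(\<integral>\<^sup>+x\<in>ball 0 r. inverse (ennreal (norm (x::'a) ^ k)) \<partial>lborel) < \<infinity>"
proof -
  let ?d = "DIM('a)"
  define V where "V = unit_ball_vol (real ?d)"
  define s where "s n = r / 2 ^ n" for n :: nat
  have s: "0 < s n" for n using assms(2) by (simp add: s_def)
  have V: "0 \<le> V" by (simp add: V_def unit_ball_vol_nonneg)
  have [measurable]: "ball (0::'a) (s n) \<in> sets borel" for n by simp
  \<comment> \<open>The factor \<open>2 ^ k\<close> pays for replacing the inner radius of a shell
    by the outer one; the power of \<open>r\<close> is what is left of \<open>s n ^ (?d - k)\<close>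
    after splitting off the powers of 1/2.\<close>
  define C where "C = 2 ^ k * r ^ (?d - k) * V"
  have "(\<integral>\<^sup>+x\<in>ball 0 r. inverse (ennreal (norm (x::'a) ^ k)) \<partial>lborel) \<le>
      (\<integral>\<^sup>+x. (\<Sum>n. ennreal (1 / s (Suc n) ^ k) * indicator (ball (0::'a) (s n)) x) \<partial>lborel)"
  proof (rule nn_integral_mono_AE)
    show "AE x in lborel. inverse (ennreal (norm (x::'a) ^ k)) * indicator (ball 0 r) x
        \<le> (\<Sum>n. ennreal (1 / s (Suc n) ^ k) * indicator (ball (0::'a) (s n)) x)"
      \<comment> \<open>The origin lies in no dyadic shell and is discarded as a null set.\<close>
      using AE_lborel_singleton[of "0::'a"]
    proof eventually_elim
      case (elim x)
      show ?case
      proof (cases "norm x < r")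
        case True
        have lim: "s \<longlonglongrightarrow> 0"
          unfolding s_def by (rule LIMSEQ_divide_realpow_zero) simp
        have "eventually (\<lambda>n. s n < norm x) sequentially"
          using elim by (intro order_tendstoD(2)[OF lim]) simp
        then obtain N where "s N < norm x" unfolding eventually_sequentially by blast
        then have "\<exists>n. s n \<le> norm x" by (intro exI[of _ N]) simp
        \<comment> \<open>The least index whose radius does not exceed \<open>norm x\<close> is
          positive because \<open>s 0 = r\<close>; its predecessor \<open>n\<close> names the shell
          containing \<open>x\<close>.\<close>
        define m where "m = (LEAST n. s n \<le> norm x)"
        have m1: "s m \<le> norm x"
          unfolding m_def by (rule LeastI_ex) fact
        have m2: "norm x < s i" if "i < m" for i
          using not_less_Least[OF that[unfolded m_def]] by (rule not_le_imp_less)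
        have "s 0 = r" by (simp add: s_def)
        with True m1 have "m \<noteq> 0" by (cases "m = 0") simp_all
        then obtain n where n: "m = Suc n" using not0_implies_Suc by blast
        have "inverse (ennreal (norm x ^ k)) \<le> ennreal (1 / s (Suc n) ^ k)"
        proof -
          have "s (Suc n) ^ k \<le> norm x ^ k"
            using m1 s[of m] by (intro power_mono) (auto simp: n)
          then have "inverse (ennreal (norm x ^ k)) \<le> inverse (ennreal (s (Suc n) ^ k))"
            by (intro inverse_ennreal_antimono ennreal_leI)
          then show ?thesis using s[of "Suc n"] by (simp add: inverse_ennreal inverse_eq_divide)
        qed
        also have "\<dots> = ennreal (1 / s (Suc n) ^ k) * indicator (ball (0::'a) (s n)) x"
          using m2[of n] n by (simp add: indicator_def)
        also have "\<dots> \<le> (\<Sum>n. ennreal (1 / s (Suc n) ^ k) * indicator (ball (0::'a) (s n)) x)"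
        proof -
          have "g n \<le> suminf g" for g :: "nat \<Rightarrow> ennreal"
            using sum_le_suminf[of g "{n}"] by simp
          then show ?thesis .
        qed
        finally show ?thesis using True by simp
      qed simp
    qed
  qed
  also have "\<dots> = (\<Sum>n. \<integral>\<^sup>+x. ennreal (1 / s (Suc n) ^ k) * indicator (ball (0::'a) (s n)) x \<partial>lborel)"
    by (rule nn_integral_suminf) measurable
  also have "\<dots> = (\<Sum>n. ennreal (1 / s (Suc n) ^ k * (V * s n ^ ?d)))"
  proof (rule arg_cong[where f = suminf], rule ext)
    fix n
    show "(\<integral>\<^sup>+x. ennreal (1 / s (Suc n) ^ k) * indicator (ball (0::'a) (s n)) x \<partial>lborel)
        = ennreal (1 / s (Suc n) ^ k * (V * s n ^ ?d))"
      using s[of n] s[of "Suc n"] V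
      by (subst nn_integral_cmult_indicator, simp, subst ennreal_mult)
         (auto simp: emeasure_ball simp flip: V_def)
  qed
  also have "\<dots> \<le> (\<Sum>n. ennreal (C * (1 / 2) ^ n))"
  proof (intro suminf_le ennreal_leI)
    fix n
    have "s n ^ ?d = s n ^ k * s n ^ (?d - k)"
      using assms(1) by (simp flip: power_add)
    moreover have "s n ^ k = 2 ^ k * s (Suc n) ^ k"
      by (simp add: s_def flip: power_mult_distrib)
    ultimately have "1 / s (Suc n) ^ k * (V * s n ^ ?d) = 2 ^ k * V * s n ^ (?d - k)"
      using s[of "Suc n"] by simp
    also have "s n ^ (?d - k) = r ^ (?d - k) * ((1 / 2) ^ n) ^ (?d - k)"
      by (simp add: s_def power_divide)
    also have "2 ^ k * V * (r ^ (?d - k) * ((1 / 2) ^ n) ^ (?d - k)) = C * ((1 / 2) ^ n) ^ (?d - k)"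
      by (simp add: C_def)
    \<comment> \<open>Here \<open>k < ?d\<close> enters: the exponent \<open>?d - k\<close> is at
      least 1.\<close>
    also have "\<dots> \<le> C * ((1 / 2) ^ n) ^ 1"
      using V assms by (intro mult_left_mono power_decreasing) (auto simp: C_def power_le_one)
    finally show "1 / s (Suc n) ^ k * (V * s n ^ ?d) \<le> C * (1 / 2) ^ n" by simp
  qed auto
  also have "\<dots> < \<infinity>"
  proof -
    have "summable (\<lambda>n. C * (1 / 2 :: real) ^ n)"
      by (intro summable_mult summable_geometric) auto
    moreover have "0 \<le> C" using V assms(2) by (simp add: C_def)
    ultimately have "(\<Sum>n. ennreal (C * (1 / 2) ^ n)) \<noteq> \<top>"
      by (intro ennreal_suminf_neq_top) auto
    then show ?thesis by (simp add: top.not_eq_extremum)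
  qed
  finally show ?thesis .
qed

section \<open>The real part of a Levy-Khintchine exponent\<close>

text \<open>For small jumps the compensated integrand is a second-order Taylor remainder, for large
  jumps it is bounded by 2. The factor \<open>2 + (norm \<xi>)^2\<close> covers both cases.\<close>

lemma integrable_levy_khintchine:
  fixes \<nu> :: "(real^'n) measure"
  assumes [measurable_cong]: "sets \<nu> = sets borel"
    and fin: "(\<integral>\<^sup>+y. ennreal (min 1 ((norm y)\<^sup>2)) \<partial>\<nu>) < \<infinity>"
  shows "integrable \<nu> (\<lambda>y. iexp (\<xi> \<bullet> y) - 1 - \<i> * of_real (\<xi> \<bullet> y) * indicator {y. norm y \<le> 1} y)"
proof (rule Bochner_Integration.integrable_bound)
  show "integrable \<nu> (\<lambda>y. (2 + (norm \<xi>)\<^sup>2) * min 1 ((norm y)\<^sup>2))"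
    using fin by (intro integrable_mult_right) (simp add: integrable_iff_bounded)
  show "AE y in \<nu>. norm (iexp (\<xi> \<bullet> y) - 1 - \<i> * of_real (\<xi> \<bullet> y) * indicator {y. norm y \<le> 1} y)
      \<le> norm ((2 + (norm \<xi>)\<^sup>2) * min 1 ((norm y)\<^sup>2))"
  proof (rule AE_I2)
    fix y
    show "norm (iexp (\<xi> \<bullet> y) - 1 - \<i> * of_real (\<xi> \<bullet> y) * indicator {y. norm y \<le> 1} y)
      \<le> norm ((2 + (norm \<xi>)\<^sup>2) * min 1 ((norm y)\<^sup>2))"
    proof (cases "norm y \<le> 1")
      case True
      have "norm (iexp (\<xi> \<bullet> y) - 1 - \<i> * of_real (\<xi> \<bullet> y)) \<le> (\<xi> \<bullet> y)\<^sup>2 / 2"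
        using iexp_approx1[of "\<xi> \<bullet> y" 1] by (simp add: numeral_2_eq_2 algebra_simps)
      also have "\<dots> \<le> (\<xi> \<bullet> y)\<^sup>2" by simp
      also have "\<dots> \<le> (norm \<xi> * norm y)\<^sup>2"
        using Cauchy_Schwarz_ineq2[of \<xi> y] by (intro abs_le_square_iff[THEN iffD1]) simp
      also have "\<dots> \<le> (2 + (norm \<xi>)\<^sup>2) * (norm y)\<^sup>2"
        by (simp add: power_mult_distrib mult_right_mono)
      also have "\<dots> = norm ((2 + (norm \<xi>)\<^sup>2) * min 1 ((norm y)\<^sup>2))"
        using True by (simp add: abs_square_le_1 min_absorb2 power_le_one)
      finally show ?thesis using True by simp
    next
      case False
      have "norm (iexp (\<xi> \<bullet> y) - 1) \<le> 2"
        using norm_triangle_ineq4[of "iexp (\<xi> \<bullet> y)" 1] by simp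
      moreover have "1 \<le> (norm y)\<^sup>2" using False by (simp add: one_le_power)
      ultimately show ?thesis using False by (simp add: min_absorb1 add_increasing2)
    qed
  qed
qed measurable

text \<open>The drift and the compensator are purely imaginary, so only nonnegative terms survive.
  Passing to \<open>ennreal\<close> lets later comparisons proceed by monotonicity, with no further
  integrability conditions.\<close>

lemma ennreal_Re_levy_khintchine:
  fixes \<nu> :: "(real^'n) measure"
  assumes sets: "sets \<nu> = sets borel"
    and fin: "(\<integral>\<^sup>+y. ennreal (min 1 ((norm y)\<^sup>2)) \<partial>\<nu>) < \<infinity>"
    and "0 \<le> a" "0 \<le> \<xi> \<bullet> (c *v \<xi>)"
  shows "0 \<le> Re (levy_khintchine a b c \<nu> \<xi>)"
    and "ennreal (Re (levy_khintchine a b c \<nu> \<xi>)) =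
      ennreal a + ennreal (\<xi> \<bullet> (c *v \<xi>) / 2) + (\<integral>\<^sup>+y. ennreal (1 - cos (\<xi> \<bullet> y)) \<partial>\<nu>)"
proof -
  let ?g = "\<lambda>y. iexp (\<xi> \<bullet> y) - 1 - \<i> * of_real (\<xi> \<bullet> y) * indicator {y. norm y \<le> 1} y"
  have g: "integrable \<nu> ?g" by (rule integrable_levy_khintchine[OF sets fin])
  have Re: "Re (?g y) = - (1 - cos (\<xi> \<bullet> y))" for y
    by (simp add: cis_conv_exp[symmetric] indicator_def)
  have int: "integrable \<nu> (\<lambda>y. 1 - cos (\<xi> \<bullet> y))"
    using integrable_Re[OF g] unfolding Re using Bochner_Integration.integrable_minus[of \<nu> "\<lambda>y. - (1 - cos (\<xi> \<bullet> y))"] by simp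
  have "Re (integral\<^sup>L \<nu> ?g) = (LINT y|\<nu>. Re (?g y))"
    using integral_Re[OF g] by simp
  then have eq: "Re (levy_khintchine a b c \<nu> \<xi>) =
      a + \<xi> \<bullet> (c *v \<xi>) / 2 + (LINT y|\<nu>. 1 - cos (\<xi> \<bullet> y))"
    unfolding levy_khintchine_def Re by (simp flip: Bochner_Integration.integral_minus)
  have nonneg: "0 \<le> (LINT y|\<nu>. 1 - cos (\<xi> \<bullet> y))"
    by (rule Bochner_Integration.integral_nonneg) simp
  show "0 \<le> Re (levy_khintchine a b c \<nu> \<xi>)"
    unfolding eq using nonneg assms(3,4) by simp
  have "(\<integral>\<^sup>+y. ennreal (1 - cos (\<xi> \<bullet> y)) \<partial>\<nu>) = ennreal (LINT y|\<nu>. 1 - cos (\<xi> \<bullet> y))"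
    by (rule nn_integral_eq_integral[OF int]) simp
  then show "ennreal (Re (levy_khintchine a b c \<nu> \<xi>)) =
      ennreal a + ennreal (\<xi> \<bullet> (c *v \<xi>) / 2) + (\<integral>\<^sup>+y. ennreal (1 - cos (\<xi> \<bullet> y)) \<partial>\<nu>)"
    unfolding eq using nonneg assms(3,4) by simp
qed

section \<open>The quadratic form with truncated jumps\<close>

text \<open>This is the expression under the infimum in (ii), at a fixed \<open>x\<close>. It is
  \<open>ennreal\<close>-valued so that it compares directly with the real part of the
  symbol.\<close>

definition truncated_form ::
    "real^'n^'n \<Rightarrow> (real^'n) measure \<Rightarrow> real \<Rightarrow> real^'n \<Rightarrow> ennreal" where
  "truncated_form c \<nu> R \<xi> =
     ennreal (\<xi> \<bullet> (c *v \<xi>)) + (\<integral>\<^sup>+y\<in>{y. norm y \<le> R}. ennreal ((\<xi> \<bullet> y)\<^sup>2) \<partial>\<nu>)"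

lemma truncated_form_mono:
  "R \<le> R' \<Longrightarrow> truncated_form c \<nu> R \<xi> \<le> truncated_form c \<nu> R' \<xi>"
  unfolding truncated_form_def
  by (intro add_left_mono nn_integral_mono) (auto simp: indicator_def)

lemma truncated_form_scaleR:
  assumes [measurable_cong]: "sets \<nu> = sets borel"
  shows "truncated_form c \<nu> R (t *\<^sub>R \<xi>) = ennreal (t\<^sup>2) * truncated_form c \<nu> R \<xi>"
proof -
  have "(t *\<^sub>R \<xi>) \<bullet> (c *v (t *\<^sub>R \<xi>)) = t\<^sup>2 * (\<xi> \<bullet> (c *v \<xi>))"
    by (simp add: matrix_vector_mult_scaleR power2_eq_square)
  moreover have "ennreal ((t *\<^sub>R \<xi> \<bullet> y)\<^sup>2) = ennreal (t\<^sup>2) * ennreal ((\<xi> \<bullet> y)\<^sup>2)" for y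
    by (simp add: power_mult_distrib ennreal_mult)
  ultimately show ?thesis
    unfolding truncated_form_def
    by (simp add: distrib_left nn_integral_cmult ennreal_mult' mult.assoc)
qed

text \<open>Parallelogram law with the nonnegative value at \<open>u - v\<close> dropped. It serves
  as the substitute for continuity in the direction.\<close>

lemma truncated_form_add_le:
  assumes [measurable_cong]: "sets \<nu> = sets borel"
    and c: "\<And>\<xi>. 0 \<le> \<xi> \<bullet> (c *v \<xi>)"
  shows "truncated_form c \<nu> R (u + v) \<le> 2 * truncated_form c \<nu> R u + 2 * truncated_form c \<nu> R v"
proof -
  have "(u + v) \<bullet> (c *v (u + v)) \<le> 2 * (u \<bullet> (c *v u)) + 2 * (v \<bullet> (c *v v))"
    using c[of "u - v"]
    by (simp add: matrix_vector_mult_diff_distrib matrix_vector_right_distrib inner_simps)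
  then have "ennreal ((u + v) \<bullet> (c *v (u + v))) \<le> ennreal (2 * (u \<bullet> (c *v u)) + 2 * (v \<bullet> (c *v v)))"
    by (rule ennreal_leI)
  also have "\<dots> = 2 * ennreal (u \<bullet> (c *v u)) + 2 * ennreal (v \<bullet> (c *v v))"
    using c by (simp add: ennreal_mult)
  finally have 1: "ennreal ((u + v) \<bullet> (c *v (u + v))) \<le>
      2 * ennreal (u \<bullet> (c *v u)) + 2 * ennreal (v \<bullet> (c *v v))" .
  have "(\<integral>\<^sup>+y\<in>{y. norm y \<le> R}. ennreal (((u + v) \<bullet> y)\<^sup>2) \<partial>\<nu>)
      \<le> (\<integral>\<^sup>+y. 2 * (ennreal ((u \<bullet> y)\<^sup>2) * indicator {y. norm y \<le> R} y) +
            2 * (ennreal ((v \<bullet> y)\<^sup>2) * indicator {y. norm y \<le> R} y) \<partial>\<nu>)"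
  proof (rule nn_integral_mono)
    fix y
    have "((u + v) \<bullet> y)\<^sup>2 \<le> 2 * (u \<bullet> y)\<^sup>2 + 2 * (v \<bullet> y)\<^sup>2"
      using zero_le_power2[of "u \<bullet> y - v \<bullet> y"] by (simp add: inner_simps power2_eq_square algebra_simps)
    then have "ennreal (((u + v) \<bullet> y)\<^sup>2) \<le> ennreal (2 * (u \<bullet> y)\<^sup>2 + 2 * (v \<bullet> y)\<^sup>2)"
      by (rule ennreal_leI)
    then show "ennreal (((u + v) \<bullet> y)\<^sup>2) * indicator {y. norm y \<le> R} y \<le>
        2 * (ennreal ((u \<bullet> y)\<^sup>2) * indicator {y. norm y \<le> R} y) +
        2 * (ennreal ((v \<bullet> y)\<^sup>2) * indicator {y. norm y \<le> R} y)"
      by (simp add: indicator_def ennreal_mult)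
  qed
  also have "\<dots> = 2 * (\<integral>\<^sup>+y\<in>{y. norm y \<le> R}. ennreal ((u \<bullet> y)\<^sup>2) \<partial>\<nu>) +
      2 * (\<integral>\<^sup>+y\<in>{y. norm y \<le> R}. ennreal ((v \<bullet> y)\<^sup>2) \<partial>\<nu>)"
    by (simp add: nn_integral_add nn_integral_cmult)
  finally show ?thesis
    unfolding truncated_form_def by (intro order_trans[OF add_mono[OF 1]]) (auto simp: distrib_left add_ac)
qed

text \<open>The condition on \<open>R\<close> gives \<open>|\<xi> \<bullet> y| \<le> 1\<close> for
  all jumps up to size \<open>R\<close>, where \<open>one_minus_cos_ge\<close> applies and produces
  the factor 4. Larger jumps only increase the right-hand side.\<close>

lemma truncated_form_le_Re_levy_khintchine:
  fixes \<nu> :: "(real^'n) measure"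
  assumes sets[measurable_cong]: "sets \<nu> = sets borel"
    and fin: "(\<integral>\<^sup>+y. ennreal (min 1 ((norm y)\<^sup>2)) \<partial>\<nu>) < \<infinity>"
    and a: "0 \<le> a" and c: "0 \<le> \<xi> \<bullet> (c *v \<xi>)" and R: "R * norm \<xi> \<le> 1"
  shows "truncated_form c \<nu> R \<xi> \<le> 4 * ennreal (Re (levy_khintchine a b c \<nu> \<xi>))"
proof -
  have "ennreal (\<xi> \<bullet> (c *v \<xi>)) \<le> ennreal (4 * (\<xi> \<bullet> (c *v \<xi>) / 2))"
    using c by (intro ennreal_leI) simp
  also have "\<dots> = 4 * ennreal (\<xi> \<bullet> (c *v \<xi>) / 2)"
    using c by (subst ennreal_mult) auto
  finally have 1: "ennreal (\<xi> \<bullet> (c *v \<xi>)) \<le> 4 * ennreal (\<xi> \<bullet> (c *v \<xi>) / 2)" .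
  have "(\<integral>\<^sup>+y\<in>{y. norm y \<le> R}. ennreal ((\<xi> \<bullet> y)\<^sup>2) \<partial>\<nu>)
      \<le> (\<integral>\<^sup>+y. 4 * ennreal (1 - cos (\<xi> \<bullet> y)) \<partial>\<nu>)"
  proof (rule nn_integral_mono)
    fix y
    have "ennreal ((\<xi> \<bullet> y)\<^sup>2) \<le> 4 * ennreal (1 - cos (\<xi> \<bullet> y))" if "norm y \<le> R"
    proof -
      have "\<bar>\<xi> \<bullet> y\<bar> \<le> norm \<xi> * norm y" by (rule Cauchy_Schwarz_ineq2)
      also have "\<dots> \<le> norm \<xi> * R" using that by (intro mult_left_mono) auto
      finally have "(\<xi> \<bullet> y)\<^sup>2 \<le> 4 * (1 - cos (\<xi> \<bullet> y))"
        using one_minus_cos_ge[of "\<xi> \<bullet> y"] R by (simp add: mult.commute)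
      then have "ennreal ((\<xi> \<bullet> y)\<^sup>2) \<le> ennreal (4 * (1 - cos (\<xi> \<bullet> y)))"
        by (rule ennreal_leI)
      also have "\<dots> = 4 * ennreal (1 - cos (\<xi> \<bullet> y))"
        by (subst ennreal_mult) auto
      finally show ?thesis .
    qed
    then show "ennreal ((\<xi> \<bullet> y)\<^sup>2) * indicator {y. norm y \<le> R} y \<le> 4 * ennreal (1 - cos (\<xi> \<bullet> y))"
      by (simp add: indicator_def)
  qed
  also have "\<dots> = 4 * (\<integral>\<^sup>+y. ennreal (1 - cos (\<xi> \<bullet> y)) \<partial>\<nu>)"
    by (rule nn_integral_cmult) measurable
  finally have "truncated_form c \<nu> R \<xi> \<le>
      4 * (ennreal (\<xi> \<bullet> (c *v \<xi>) / 2) + (\<integral>\<^sup>+y. ennreal (1 - cos (\<xi> \<bullet> y)) \<partial>\<nu>))"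
    unfolding truncated_form_def distrib_left by (intro add_mono 1)
  also have "\<dots> \<le> 4 * ennreal (Re (levy_khintchine a b c \<nu> \<xi>))"
    unfolding ennreal_Re_levy_khintchine(2)[where c = c, OF sets fin a c] add.assoc
    by (intro mult_left_mono) (auto intro: add_increasing)
  finally show ?thesis .
qed

section \<open>Estimates for the symbol, uniform in \<open>x\<close>\<close>

context nice_feller_process
begin

lemma Re_symbol_nonneg: "0 \<le> Re (q x \<xi>)"
  unfolding symbol_eq
  by (rule ennreal_Re_levy_khintchine(1)[OF sets_\<nu> \<nu>_integrable a_nonneg c_nonneg])

lemma ennreal_Re_symbol:
  "ennreal (Re (q x \<xi>)) = ennreal (\<xi> \<bullet> (c x *v \<xi>) / 2) + (\<integral>\<^sup>+y. ennreal (1 - cos (\<xi> \<bullet> y)) \<partial>\<nu> x)"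
  using ennreal_Re_levy_khintchine(2)[where a = "a x" and b = "b x" and c = "c x" and \<nu> = "\<nu> x" and \<xi> = \<xi>,
      OF sets_\<nu> \<nu>_integrable a_nonneg c_nonneg]
  by (simp add: symbol_eq C3(2))

lemma truncated_form_le_Re_symbol:
  "R * norm \<xi> \<le> 1 \<Longrightarrow> truncated_form (c x) (\<nu> x) R \<xi> \<le> 4 * ennreal (Re (q x \<xi>))"
  unfolding symbol_eq
  by (rule truncated_form_le_Re_levy_khintchine[OF sets_\<nu> \<nu>_integrable a_nonneg c_nonneg])

text \<open>On vectors of norm \<open>1 / R\<close> the form is controlled by the symbol, hence by
  (C2) uniformly in \<open>x\<close>. Homogeneity of degree two extends the bound to every
  \<open>v\<close>.\<close>

lemma truncated_form_bounded:
  assumes "0 < R"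
  obtains K where "0 \<le> K" "\<And>x v. truncated_form (c x) (\<nu> x) R v \<le> ennreal (K * (norm v)\<^sup>2)"
proof -
  from C2 obtain C where C: "0 \<le> C" "\<And>x \<xi>. norm (q x \<xi>) \<le> C * (1 + (norm \<xi>)\<^sup>2)" by blast
  \<comment> \<open>This is 4 times the (C2) bound at norm \<open>1 / R\<close>, multiplied by the
    factor \<open>R^2\<close> from rescaling.\<close>
  define K where "K = 4 * C * (R\<^sup>2 + 1)"
  show ?thesis
  proof (rule that)
    show "0 \<le> K" using C by (simp add: K_def)
    fix x v
    show "truncated_form (c x) (\<nu> x) R v \<le> ennreal (K * (norm v)\<^sup>2)"
    proof (cases "v = 0")
      case True
      then show ?thesis by (simp add: truncated_form_def)
    next
      case False
      define t where "t = R * norm v"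
      define w where "w = (1 / t) *\<^sub>R v"
      have t: "0 < t" using False assms by (simp add: t_def)
      have w: "norm w = 1 / R" "v = t *\<^sub>R w"
        using False assms by (simp_all add: w_def t_def)
      have "truncated_form (c x) (\<nu> x) R w \<le> 4 * ennreal (Re (q x w))"
        using assms w(1) by (intro truncated_form_le_Re_symbol) simp
      also have "\<dots> \<le> 4 * ennreal (C * (1 + (1 / R)\<^sup>2))"
        using C(2)[of x w] complex_Re_le_cmod[of "q x w"] w(1)
        by (intro mult_left_mono ennreal_leI) auto
      also have "\<dots> = ennreal (4 * (C * (1 + (1 / R)\<^sup>2)))"
        using C(1) by (subst ennreal_mult) auto
      finally have "ennreal (t\<^sup>2) * truncated_form (c x) (\<nu> x) R w \<le>
          ennreal (t\<^sup>2) * ennreal (4 * (C * (1 + (1 / R)\<^sup>2)))"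
        by (intro mult_left_mono) auto
      also have "\<dots> = ennreal (t\<^sup>2 * (4 * (C * (1 + (1 / R)\<^sup>2))))"
        using C(1) by (simp add: ennreal_mult)
      also have "t\<^sup>2 * (4 * (C * (1 + (1 / R)\<^sup>2))) = K * (norm v)\<^sup>2"
        using assms by (simp add: t_def K_def field_simps power2_eq_square)
      finally show ?thesis
        unfolding w(2) by (simp add: truncated_form_scaleR[OF sets_\<nu>])
    qed
  qed
qed

text \<open>Compactness of the unit sphere removes the dependence of the radius on the direction: by (C2)
  the forms with a given radius are continuous in the direction, uniformly in \<open>x\<close>.\<close>

lemma truncated_form_uniform_radius:
  assumes "0 < \<delta>"
    and dir: "\<And>u. norm u = 1 \<Longrightarrow> \<exists>R>0. \<forall>x. ennreal \<delta> \<le> truncated_form (c x) (\<nu> x) R u"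
  obtains R where "0 < R"
    "\<And>x u. norm u = 1 \<Longrightarrow> ennreal (\<delta> / 4) \<le> truncated_form (c x) (\<nu> x) R u"
proof -
  have "\<exists>R e. 0 < R \<and> 0 < e \<and>
      (\<forall>x. \<forall>v\<in>ball u e. ennreal (\<delta> / 4) \<le> truncated_form (c x) (\<nu> x) R v)"
    if u: "norm u = 1" for u
  proof -
    obtain R where R: "0 < R" "\<And>x. ennreal \<delta> \<le> truncated_form (c x) (\<nu> x) R u"
      using dir[OF u] by blast
    obtain K where K: "0 \<le> K" "\<And>x v. truncated_form (c x) (\<nu> x) R v \<le> ennreal (K * (norm v)\<^sup>2)"
      using truncated_form_bounded[OF R(1)] by blast
    \<comment> \<open>Chosen so that \<open>K * e^2 \<le> \<delta> / 4\<close>; the summand 1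
      excludes division by zero.\<close>
    define e where "e = sqrt (\<delta> / (4 * (K + 1)))"
    have e: "0 < e" "e\<^sup>2 = \<delta> / (4 * (K + 1))"
      using assms(1) K(1) by (simp_all add: e_def)
    have "ennreal (\<delta> / 4) \<le> truncated_form (c x) (\<nu> x) R v" if v: "v \<in> ball u e" for x v
    proof -
      have "(norm (u - v))\<^sup>2 \<le> e\<^sup>2"
        using v by (intro power_mono) (auto simp: dist_norm)
      then have "K * (norm (u - v))\<^sup>2 \<le> K * e\<^sup>2" using K(1) by (rule mult_left_mono)
      also have "\<dots> \<le> \<delta> / 4"
        using K(1) assms(1) by (simp add: e(2) field_simps)
      finally have "truncated_form (c x) (\<nu> x) R (u - v) \<le> ennreal (\<delta> / 4)"
        using K(2)[of x "u - v"] by (meson ennreal_leI order_trans)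
      then have "2 * truncated_form (c x) (\<nu> x) R v + 2 * truncated_form (c x) (\<nu> x) R (u - v)
          \<le> 2 * truncated_form (c x) (\<nu> x) R v + 2 * ennreal (\<delta> / 4)"
        by (intro add_left_mono mult_left_mono) auto
      \<comment> \<open>Apply the parallelogram bound to u = v + (u - v).\<close>
      moreover have "ennreal \<delta> \<le>
          2 * truncated_form (c x) (\<nu> x) R v + 2 * truncated_form (c x) (\<nu> x) R (u - v)"
        using truncated_form_add_le[of "\<nu> x" "c x" R v "u - v", OF sets_\<nu> c_nonneg] R(2)[of x] by simp
      \<comment> \<open>Half of \<open>\<delta>\<close> is absorbed by the perturbation; the other
        half is at most twice the form at \<open>v\<close>, whence the quarter.\<close>
      ultimately have *: "ennreal \<delta> \<le> 2 * truncated_form (c x) (\<nu> x) R v + 2 * ennreal (\<delta> / 4)"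
        by (rule order_trans[rotated])
      show ?thesis
      proof (cases "truncated_form (c x) (\<nu> x) R v")
        case (real z)
        have "ennreal (2 * z + 2 * (\<delta> / 4)) = ennreal (2 * z) + ennreal (2 * (\<delta> / 4))"
          using real assms(1) by (intro ennreal_plus) auto
        also have "\<dots> = 2 * ennreal z + 2 * ennreal (\<delta> / 4)"
          using real assms(1) ennreal_mult[of 2 z] ennreal_mult[of 2 "\<delta> / 4"] by simp
        finally have "2 * ennreal z + 2 * ennreal (\<delta> / 4) = ennreal (2 * z + 2 * (\<delta> / 4))" ..
        then have "\<delta> \<le> 2 * z + 2 * (\<delta> / 4)"
          using * real assms(1) ennreal_le_iff[of "2 * z + 2 * (\<delta> / 4)" \<delta>] by (simp del: ennreal_plus)
        then show ?thesis using real by (simp add: ennreal_leI)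
      qed simp
    qed
    with R(1) e(1) show ?thesis by blast
  qed
  then obtain R e where Re: "\<And>u. norm u = 1 \<Longrightarrow> 0 < R u \<and> 0 < e u"
    "\<And>u x v. norm u = 1 \<Longrightarrow> v \<in> ball u (e u) \<Longrightarrow> ennreal (\<delta> / 4) \<le> truncated_form (c x) (\<nu> x) (R u) v"
    by metis
  have cover: "sphere 0 1 \<subseteq> (\<Union>u\<in>sphere 0 1. ball u (e u))"
  proof
    fix u :: "real^'n" assume "u \<in> sphere 0 1"
    then show "u \<in> (\<Union>u\<in>sphere 0 1. ball u (e u))" using Re(1) by (intro UN_I[of u]) auto
  qed
  obtain D where D: "D \<subseteq> sphere 0 1" "finite D" "sphere 0 1 \<subseteq> (\<Union>u\<in>D. ball u (e u))"
    by (rule compactE_image[OF compact_sphere open_ball cover])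
  \<comment> \<open>The form grows with the radius, so the largest of finitely many radii serves
    everywhere. The inserted 1 makes the maximum well defined and positive whatever \<open>D\<close>
    is.\<close>
  define R' where "R' = Max (insert 1 (R ` D))"
  show ?thesis
  proof (rule that)
    show "0 < R'" unfolding R'_def using D(2) by (intro less_le_trans[OF zero_less_one Max_ge]) auto
    fix x u assume "norm (u :: real^'n) = 1"
    then obtain w where w: "w \<in> D" "u \<in> ball w (e w)" using D(3) by fastforce
    then have "ennreal (\<delta> / 4) \<le> truncated_form (c x) (\<nu> x) (R w) u"
      using D(1) by (intro Re(2)) auto
    also have "\<dots> \<le> truncated_form (c x) (\<nu> x) R' u"
      using w D(2) by (intro truncated_form_mono) (simp add: R'_def)
    finally show "ennreal (\<delta> / 4) \<le> truncated_form (c x) (\<nu> x) R' u" .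
  qed
qed

section \<open>Divergence and convergence of the reciprocal symbol integrals\<close>

text \<open>Symmetry makes the modulus of the symbol equal to its real part. The diffusion part is
  quadratically bounded by (C2) and the jump part by the second moments, uniformly in
  \<open>x\<close>.\<close>

lemma nn_integral_inverse_symbol_infinite:
  assumes "symmetric_symbol q" "CARD('n) \<le> 2"
    and fin: "(SUP x. \<integral>\<^sup>+y. ennreal ((norm y)\<^sup>2) \<partial>\<nu> x) < \<infinity>"
    and "0 < r"
  shows "(\<integral>\<^sup>+\<xi>\<in>ball 0 r. 1 / (SUP x. ennreal (norm (q x \<xi>))) \<partial>lborel) = \<infinity>"
proof -
  obtain S where S: "(SUP x. \<integral>\<^sup>+y. ennreal ((norm y)\<^sup>2) \<partial>\<nu> x) = ennreal S" "0 \<le> S"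
    using fin by (cases "SUP x. \<integral>\<^sup>+y. ennreal ((norm y)\<^sup>2) \<partial>\<nu> x") auto
  \<comment> \<open>The form at radius 1 dominates its diffusion part, so this yields a uniform
    bound on \<open>c\<close>.\<close>
  obtain C where C: "0 \<le> C" "\<And>x v. truncated_form (c x) (\<nu> x) 1 v \<le> ennreal (C * (norm v)\<^sup>2)"
    using truncated_form_bounded[of 1] by auto
  define K where "K = C + S + 1"
  have K: "0 < K" using C S by (simp add: K_def)
  have bound: "(SUP x. ennreal (norm (q x \<xi>))) \<le> ennreal (K * (norm \<xi>)\<^sup>2)" for \<xi>
  proof (rule SUP_least)
    fix x
    have "norm (q x \<xi>) = Re (q x \<xi>)"
      using assms(1) Re_symbol_nonneg[of x \<xi>] unfolding symmetric_symbol_def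
      by (metis abs_of_nonneg norm_of_real)
    then have "ennreal (norm (q x \<xi>)) =
        ennreal (\<xi> \<bullet> (c x *v \<xi>) / 2) + (\<integral>\<^sup>+y. ennreal (1 - cos (\<xi> \<bullet> y)) \<partial>\<nu> x)"
      by (simp add: ennreal_Re_symbol)
    also have "\<dots> \<le> ennreal (C * (norm \<xi>)\<^sup>2) + ennreal ((norm \<xi>)\<^sup>2 * S)"
    proof (rule add_mono)
      have "ennreal (\<xi> \<bullet> (c x *v \<xi>) / 2) \<le> ennreal (\<xi> \<bullet> (c x *v \<xi>))"
        using c_nonneg[of \<xi> x] by (intro ennreal_leI) simp
      also have "\<dots> \<le> truncated_form (c x) (\<nu> x) 1 \<xi>" by (simp add: truncated_form_def)
      finally show "ennreal (\<xi> \<bullet> (c x *v \<xi>) / 2) \<le> ennreal (C * (norm \<xi>)\<^sup>2)"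
        using C(2) order_trans by blast
      note [measurable_cong] = sets_\<nu>
      have "(\<integral>\<^sup>+y. ennreal (1 - cos (\<xi> \<bullet> y)) \<partial>\<nu> x) \<le>
          (\<integral>\<^sup>+y. ennreal ((norm \<xi>)\<^sup>2) * ennreal ((norm y)\<^sup>2) \<partial>\<nu> x)"
      proof (rule nn_integral_mono)
        fix y
        have "1 - cos (\<xi> \<bullet> y) \<le> (\<xi> \<bullet> y)\<^sup>2 / 2" by (rule one_minus_cos_le)
        also have "\<dots> \<le> (\<xi> \<bullet> y)\<^sup>2" by simp
        also have "\<dots> \<le> (norm \<xi> * norm y)\<^sup>2"
          using Cauchy_Schwarz_ineq2[of \<xi> y] by (intro abs_le_square_iff[THEN iffD1]) simp
        finally show "ennreal (1 - cos (\<xi> \<bullet> y)) \<le> ennreal ((norm \<xi>)\<^sup>2) * ennreal ((norm y)\<^sup>2)"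
          by (simp add: power_mult_distrib ennreal_leI flip: ennreal_mult)
      qed
      also have "\<dots> = ennreal ((norm \<xi>)\<^sup>2) * (\<integral>\<^sup>+y. ennreal ((norm y)\<^sup>2) \<partial>\<nu> x)"
        by (rule nn_integral_cmult) measurable
      also have "\<dots> \<le> ennreal ((norm \<xi>)\<^sup>2) * ennreal S"
        unfolding S(1)[symmetric] by (intro mult_left_mono SUP_upper) auto
      finally show "(\<integral>\<^sup>+y. ennreal (1 - cos (\<xi> \<bullet> y)) \<partial>\<nu> x) \<le> ennreal ((norm \<xi>)\<^sup>2 * S)"
        using S(2) by (simp add: ennreal_mult)
    qed
    also have "\<dots> = ennreal (C * (norm \<xi>)\<^sup>2 + (norm \<xi>)\<^sup>2 * S)"
      using C(1) S(2) by simp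
    also have "\<dots> \<le> ennreal (K * (norm \<xi>)\<^sup>2)"
      by (intro ennreal_leI) (simp add: K_def algebra_simps)
    finally show "ennreal (norm (q x \<xi>)) \<le> ennreal (K * (norm \<xi>)\<^sup>2)" .
  qed
  have [measurable]: "ball (0::real^'n) r \<in> sets borel" by simp
  have "\<infinity> = inverse (ennreal K) * (\<integral>\<^sup>+\<xi>\<in>ball 0 r. inverse (ennreal (norm (\<xi>::real^'n) ^ 2)) \<partial>lborel)"
    using nn_integral_inverse_norm_power_ball_infinite[where 'a = "real^'n", of 2 r] assms K
    by (simp add: ennreal_mult_top inverse_ennreal)
  also have "\<dots> = (\<integral>\<^sup>+\<xi>\<in>ball 0 r. inverse (ennreal K) * inverse (ennreal (norm (\<xi>::real^'n) ^ 2)) \<partial>lborel)"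
    unfolding mult.assoc by (rule nn_integral_cmult[symmetric]) measurable
  also have "\<dots> \<le> (\<integral>\<^sup>+\<xi>\<in>ball 0 r. 1 / (SUP x. ennreal (norm (q x \<xi>))) \<partial>lborel)"
  proof (intro nn_integral_mono mult_right_mono)
    fix \<xi> :: "real^'n"
    have "inverse (ennreal K) * inverse (ennreal (norm \<xi> ^ 2)) = inverse (ennreal (K * (norm \<xi>)\<^sup>2))"
      using K by (simp add: ennreal_mult ennreal_inverse_mult)
    also have "\<dots> \<le> 1 / (SUP x. ennreal (norm (q x \<xi>)))"
      unfolding divide_ennreal_def using bound[of \<xi>] by (simp add: inverse_ennreal_antimono)
    finally show "inverse (ennreal K) * inverse (ennreal (norm \<xi> ^ 2)) \<le> 1 / (SUP x. ennreal (norm (q x \<xi>)))" .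
  qed simp
  finally show ?thesis by (simp add: top.extremum_unique)
qed

text \<open>The \<open>Liminf\<close> condition yields a lower bound for the form in each direction,
  with a radius depending on that direction. A common radius turns this into a quadratic lower bound
  for the real part of the symbol near 0.\<close>

lemma nn_integral_inverse_symbol_finite:
  assumes "CARD('n) \<ge> 3"
    and liminf: "Liminf (at 0) (\<lambda>\<xi>. (SUP R\<in>{0<..}. INF x. truncated_form (c x) (\<nu> x) R \<xi>)
          / ennreal ((norm \<xi>)\<^sup>2)) > 0"
  shows "\<exists>r>0. (\<integral>\<^sup>+\<xi>\<in>ball 0 r. 1 / (INF x. ennreal (Re (q x \<xi>))) \<partial>lborel) < \<infinity>"
proof -
  define H where "H \<xi> = (SUP R\<in>{0<..}. INF x. truncated_form (c x) (\<nu> x) R \<xi>)" for \<xi>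
  \<comment> \<open>A value strictly below the \<open>Liminf\<close> is exceeded throughout a
    punctured neighbourhood of 0, and it is finite, hence a real \<open>\<delta>\<close>.\<close>
  obtain y where y: "0 < y" "y < Liminf (at 0) (\<lambda>\<xi>. H \<xi> / ennreal ((norm \<xi>)\<^sup>2))"
    using dense[OF liminf] unfolding H_def by blast
  obtain \<delta> where \<delta>: "y = ennreal \<delta>" "0 < \<delta>"
    using y by (cases y) (auto simp: ennreal_less_zero_iff)
  have "eventually (\<lambda>\<xi>. y < H \<xi> / ennreal ((norm \<xi>)\<^sup>2)) (at 0)"
    by (rule less_LiminfD[OF y(2)])
  then obtain \<rho> where \<rho>: "0 < \<rho>" "\<And>\<xi>. \<xi> \<noteq> 0 \<Longrightarrow> norm \<xi> < \<rho> \<Longrightarrow> y < H \<xi> / ennreal ((norm \<xi>)\<^sup>2)"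
    by (auto simp: eventually_at dist_norm)
  have "\<exists>R>0. \<forall>x. ennreal \<delta> \<le> truncated_form (c x) (\<nu> x) R u" if u: "norm u = 1" for u
  proof -
    \<comment> \<open>One point on the ray inside that neighbourhood suffices, since homogeneity
      carries the bound to the unit vector \<open>u\<close>.\<close>
    define t where "t = \<rho> / 2"
    have t: "0 < t" "t < \<rho>" using \<rho>(1) by (auto simp: t_def)
    have nt: "norm (t *\<^sub>R u) = t" using u t by simp
    have "y < H (t *\<^sub>R u) / ennreal (t\<^sup>2)"
      using \<rho>(2)[of "t *\<^sub>R u"] t u unfolding nt by force
    have "y * ennreal (t\<^sup>2) < H (t *\<^sub>R u)"
    proof (rule ccontr)
      assume "\<not> ?thesis"
      then have "H (t *\<^sub>R u) / ennreal (t\<^sup>2) \<le> y * ennreal (t\<^sup>2) / ennreal (t\<^sup>2)"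
        by (intro divide_right_mono_ennreal) simp
      then show False using \<open>y < H (t *\<^sub>R u) / ennreal (t\<^sup>2)\<close> t
        by (simp add: ennreal_mult_divide_eq)
    qed
    \<comment> \<open>Strictness allows a single radius to be picked from the supremum.\<close>
    then obtain R where R: "0 < R" "y * ennreal (t\<^sup>2) < (INF x. truncated_form (c x) (\<nu> x) R (t *\<^sub>R u))"
      unfolding H_def less_SUP_iff by auto
    have "y \<le> truncated_form (c x) (\<nu> x) R u" for x
    proof -
      have "y * ennreal (t\<^sup>2) \<le> truncated_form (c x) (\<nu> x) R (t *\<^sub>R u)"
        using R(2) by (meson INF_lower UNIV_I less_imp_le order_trans)
      then have "ennreal (t\<^sup>2) * y \<le> ennreal (t\<^sup>2) * truncated_form (c x) (\<nu> x) R u"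
        by (simp add: truncated_form_scaleR[OF sets_\<nu>] mult.commute)
      then show ?thesis using t by (subst (asm) ennreal_mult_le_mult_iff) auto
    qed
    with R(1) \<delta> show ?thesis by blast
  qed
  then obtain R where R: "0 < R"
    "\<And>x u. norm u = 1 \<Longrightarrow> ennreal (\<delta> / 4) \<le> truncated_form (c x) (\<nu> x) R u"
    using truncated_form_uniform_radius[OF \<delta>(2)] by blast
  \<comment> \<open>Inside this ball \<open>R * norm \<xi> \<le> 1\<close>, as the comparison with
    the symbol demands.\<close>
  define r where "r = 1 / R"
  have [measurable]: "ball (0::real^'n) r \<in> sets borel" by simp
  \<comment> \<open>One factor 1/4 is lost in making the radius uniform, another in the cosine
    estimate.\<close>
  define \<kappa> where "\<kappa> = \<delta> / 16"
  have r: "0 < r" and \<kappa>: "0 < \<kappa>" using R(1) \<delta>(2) by (auto simp: r_def \<kappa>_def)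
  have bound: "ennreal (\<kappa> * (norm \<xi>)\<^sup>2) \<le> (INF x. ennreal (Re (q x \<xi>)))" if "norm \<xi> < r" for \<xi>
  proof (rule INF_greatest)
    fix x
    show "ennreal (\<kappa> * (norm \<xi>)\<^sup>2) \<le> ennreal (Re (q x \<xi>))"
    proof (cases "\<xi> = 0")
      case False
      define u where "u = (1 / norm \<xi>) *\<^sub>R \<xi>"
      have u: "norm u = 1" "\<xi> = norm \<xi> *\<^sub>R u" using False by (auto simp: u_def)
      have "ennreal ((norm \<xi>)\<^sup>2 * (\<delta> / 4)) = ennreal ((norm \<xi>)\<^sup>2) * ennreal (\<delta> / 4)"
        using \<delta>(2) by (intro ennreal_mult) auto
      also have "\<dots> \<le> ennreal ((norm \<xi>)\<^sup>2) * truncated_form (c x) (\<nu> x) R u"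
        by (intro mult_left_mono R(2) u) simp
      also have "\<dots> = truncated_form (c x) (\<nu> x) R \<xi>"
        by (subst (2) u(2)) (simp add: truncated_form_scaleR[OF sets_\<nu>])
      also have "\<dots> \<le> 4 * ennreal (Re (q x \<xi>))"
        using that R(1) by (intro truncated_form_le_Re_symbol) (simp add: r_def field_simps)
      also have "\<dots> = ennreal (4 * Re (q x \<xi>))"
        using Re_symbol_nonneg by (subst ennreal_mult) auto
      finally have "(norm \<xi>)\<^sup>2 * (\<delta> / 4) \<le> 4 * Re (q x \<xi>)"
        using Re_symbol_nonneg[of x \<xi>] by (subst (asm) ennreal_le_iff) auto
      then show ?thesis by (intro ennreal_leI) (simp add: \<kappa>_def mult.commute)
    qed simp
  qed
  have "(\<integral>\<^sup>+\<xi>\<in>ball 0 r. 1 / (INF x. ennreal (Re (q x \<xi>))) \<partial>lborel) \<le>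
      (\<integral>\<^sup>+\<xi>\<in>ball 0 r. inverse (ennreal \<kappa>) * inverse (ennreal (norm (\<xi>::real^'n) ^ 2)) \<partial>lborel)"
  proof (intro nn_integral_mono)
    fix \<xi> :: "real^'n"
    have "1 / (INF x. ennreal (Re (q x \<xi>))) \<le> inverse (ennreal \<kappa>) * inverse (ennreal (norm \<xi> ^ 2))"
      if "norm \<xi> < r"
    proof -
      have "1 / (INF x. ennreal (Re (q x \<xi>))) \<le> inverse (ennreal (\<kappa> * (norm \<xi>)\<^sup>2))"
        unfolding divide_ennreal_def using bound[OF that] by (simp add: inverse_ennreal_antimono)
      also have "\<dots> = inverse (ennreal \<kappa>) * inverse (ennreal (norm \<xi> ^ 2))"
        using \<kappa> by (simp add: ennreal_mult ennreal_inverse_mult)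
      finally show ?thesis .
    qed
    then show "1 / (INF x. ennreal (Re (q x \<xi>))) * indicator (ball 0 r) \<xi> \<le>
        inverse (ennreal \<kappa>) * inverse (ennreal (norm \<xi> ^ 2)) * indicator (ball 0 r) \<xi>"
      by (simp add: indicator_def)
  qed
  also have "\<dots> = inverse (ennreal \<kappa>) * (\<integral>\<^sup>+\<xi>\<in>ball 0 r. inverse (ennreal (norm (\<xi>::real^'n) ^ 2)) \<partial>lborel)"
    unfolding mult.assoc by (rule nn_integral_cmult) measurable
  also have "\<dots> < \<infinity>"
    using nn_integral_inverse_norm_power_ball_finite[where 'a = "real^'n", of 2 r] assms r \<kappa>
    by (simp add: ennreal_mult_less_top inverse_ennreal)
  finally show ?thesis using r by blast
qed

end

theorem theorem2p8:
  fixes M :: "'w measure" and Flt :: "real \<Rightarrow> 'w measure"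
    and P :: "real^'n \<Rightarrow> 'w measure" and F :: "real \<Rightarrow> 'w \<Rightarrow> real^'n"
    and q :: "real^'n \<Rightarrow> real^'n \<Rightarrow> complex"
    and a :: "real^'n \<Rightarrow> real" and b :: "real^'n \<Rightarrow> real^'n"
    and c :: "real^'n \<Rightarrow> real^'n^'n" and \<nu> :: "real^'n \<Rightarrow> (real^'n) measure"
  assumes "nice_feller_process M Flt P F q a b c \<nu>"
  shows
    "(symmetric_symbol q \<and> CARD('n) \<in> {1, 2} \<and>
        (SUP x. \<integral>\<^sup>+y. ennreal ((norm y)\<^sup>2) \<partial>\<nu> x) < \<infinity>
      \<longrightarrow> (\<exists>r>0. (\<integral>\<^sup>+\<xi>\<in>ball 0 r. 1 / (SUP x. ennreal (norm (q x \<xi>))) \<partial>lborel) = \<infinity>))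
     \<and>
     (CARD('n) \<ge> 3 \<and>
        Liminf (at 0) (\<lambda>\<xi>. (SUP R\<in>{0<..}. INF x. ennreal (\<xi> \<bullet> (c x *v \<xi>))
              + (\<integral>\<^sup>+y\<in>{y. norm y \<le> R}. ennreal ((\<xi> \<bullet> y)\<^sup>2) \<partial>\<nu> x))
            / ennreal ((norm \<xi>)\<^sup>2)) > 0
      \<longrightarrow> (\<exists>r>0. (\<integral>\<^sup>+\<xi>\<in>ball 0 r. 1 / (INF x. ennreal (Re (q x \<xi>))) \<partial>lborel) < \<infinity>))"
proof -
  interpret nice_feller_process M Flt P F q a b c \<nu> by (rule assms)
  show ?thesis
  proof (intro conjI impI; elim conjE)
    assume "symmetric_symbol q" "CARD('n) \<in> {1, 2}"
      "(SUP x. \<integral>\<^sup>+y. ennreal ((norm y)\<^sup>2) \<partial>\<nu> x) < \<infinity>"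
    \<comment> \<open>The divergence holds for every radius; 1 is picked as a witness.\<close>
    then have "(\<integral>\<^sup>+\<xi>\<in>ball 0 1. 1 / (SUP x. ennreal (norm (q x \<xi>))) \<partial>lborel) = \<infinity>"
      by (intro nn_integral_inverse_symbol_infinite) auto
    then show "\<exists>r>0. (\<integral>\<^sup>+\<xi>\<in>ball 0 r. 1 / (SUP x. ennreal (norm (q x \<xi>))) \<partial>lborel) = \<infinity>"
      using zero_less_one by blast
  next
    assume "CARD('n) \<ge> 3" and "Liminf (at 0) (\<lambda>\<xi>. (SUP R\<in>{0<..}. INF x. ennreal (\<xi> \<bullet> (c x *v \<xi>))
              + (\<integral>\<^sup>+y\<in>{y. norm y \<le> R}. ennreal ((\<xi> \<bullet> y)\<^sup>2) \<partial>\<nu> x))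
            / ennreal ((norm \<xi>)\<^sup>2)) > 0"
    then show "\<exists>r>0. (\<integral>\<^sup>+\<xi>\<in>ball 0 r. 1 / (INF x. ennreal (Re (q x \<xi>))) \<partial>lborel) < \<infinity>"
      unfolding truncated_form_def[symmetric] by (rule nn_integral_inverse_symbol_finite)
  qed
qed

end
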